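(* Fix $x\in\mathbb R^d$. If $k/n\to0$ as $n\to\infty$, then $$ w_{\mathrm{fact}}(x) =\frac{1}{k}\sum_{j=1}^{k}\exp\big(-\|x-U_{(j)}(x)\|^2\big) \;\longrightarrow\;\exp\big(-d(x,S)^2\big)\quad\text{almost surely}. $$ In particular, $w_{\mathrm{fact}}(x)\to1$ almost surely for $x\in S$.
   Context: Let $\|\cdot\|$ be a norm on $\mathbb R^d$ and let $U_1,U_2,\ldots$ be i.i.d. random vectors in $\mathbb R^d$ with law $Q_U$. Let $S=\operatorname{supp}(Q_U)$ be the (closed) support of $Q_U$ and $d(x,S)=\inf_{u\in S}\|x-u\|$. The integer $k=k_n$, $1\leqslant k\leqslant n$, is deterministic and may depend on $n$. For $x\in\mathbb R^d$, $U_{(1)}(x),\ldots,U_{(k)}(x)$ denote the $k$ nearest neighbors of $x$ among $U_1,\ldots,U_n$, in order of increasing distance to $x$ (ties broken by index order). *)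

theory Defs
  imports "HOL-Probability.Probability"
begin

(* An arbitrary norm on a real vector space, as opposed to the Euclidean norm that is
   built into the type real ^ 'd. *)
definition is_norm :: "('a::real_vector \<Rightarrow> real) \<Rightarrow> bool" where
  "is_norm N \<longleftrightarrow>
     (\<forall>v. 0 \<le> N v) \<and>
     (\<forall>v. N v = 0 \<longleftrightarrow> v = 0) \<and>
     (\<forall>a v. N (a *\<^sub>R v) = \<bar>a\<bar> * N v) \<and>
     (\<forall>v w. N (v + w) \<le> N v + N w)"

(* The open sets are those of the type's own topology; in finite dimension every norm
   induces the same one. *)
definition supp :: "'a::topological_space measure \<Rightarrow> 'a set" where
  "supp Q = {u. \<forall>V. open V \<longrightarrow> u \<in> V \<longrightarrow> 0 < emeasure Q V}"

definition dist_to :: "('a::real_vector \<Rightarrow> real) \<Rightarrow> 'a \<Rightarrow> 'a set \<Rightarrow> real" where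
  "dist_to N x S = (INF u\<in>S. N (x - u))"

(* The indices 1..n listed by increasing distance of the point to x. The sort is stable
   (sort_key_stable), so ties are broken by index order. *)
definition nn_order ::
  "('a::real_vector \<Rightarrow> real) \<Rightarrow> (nat \<Rightarrow> 'a) \<Rightarrow> nat \<Rightarrow> 'a \<Rightarrow> nat list" where
  "nn_order N u n x = sort_key (\<lambda>i. N (x - u i)) [1..<Suc n]"

(* The j-th nearest neighbour of x among u 1, ..., u n, for j in {1..n}; list positions
   start at 0. *)
definition nn ::
  "('a::real_vector \<Rightarrow> real) \<Rightarrow> (nat \<Rightarrow> 'a) \<Rightarrow> nat \<Rightarrow> 'a \<Rightarrow> nat \<Rightarrow> 'a" where
  "nn N u n x j = u (nn_order N u n x ! (j - 1))"

definition w_fact ::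
  "('a::real_vector \<Rightarrow> real) \<Rightarrow> (nat \<Rightarrow> 'a) \<Rightarrow> nat \<Rightarrow> nat \<Rightarrow> 'a \<Rightarrow> real" where
  "w_fact N u n k x = (1 / real k) * (\<Sum>j=1..k. exp (- (N (x - nn N u n x j))\<^sup>2))"

end

theory Submission
  imports Defs
begin

text \<open>
  Let \<open>d\<close> be the distance from \<open>x\<close> to the support. Almost surely every sample point lies in the
  support, so no neighbour is at distance less than \<open>d\<close> from \<open>x\<close>, and \<open>w_fact\<close>, an average of
  \<open>exp (- r\<^sup>2)\<close> over the distances \<open>r\<close> of the neighbours, never exceeds \<open>exp (- d\<^sup>2)\<close>.

  For the lower bound take \<open>r > d\<close>. The ball of radius \<open>r\<close> around \<open>x\<close> is open, because a norm on a
  finite-dimensional space is continuous, and it meets the support, so it has positive probability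
  \<open>p\<close>. Almost surely more than \<open>n p / 2\<close> of the first \<open>n\<close> sample points eventually fall into it
  (\<open>AE_eventually_card_hits\<close>), whereas \<open>k n\<close> is eventually below \<open>n p / 2\<close>. So all \<open>k n\<close> nearest
  neighbours eventually lie in the ball (\<open>nn_less\<close>) and \<open>w_fact\<close> is at least \<open>exp (- r\<^sup>2)\<close>.
  Letting \<open>r\<close> decrease to \<open>d\<close> along a sequence keeps the exceptional set null.

  The linear lower bound on the number of hits comes from Hoeffding's inequality, whose exponentially
  small error probabilities are summable, and the Borel--Cantelli lemma.
\<close>

section \<open>Norms and supports\<close>

lemma is_norm_nonneg: "is_norm N \<Longrightarrow> 0 \<le> N v"
  by (simp add: is_norm_def)

lemma is_norm_zero: "is_norm N \<Longrightarrow> N 0 = 0"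
  by (simp add: is_norm_def)

text \<open>A norm is convex, and convex functions on a finite-dimensional space are continuous.\<close>

lemma is_norm_continuous:
  fixes N :: "'a::euclidean_space \<Rightarrow> real"
  assumes "is_norm N"
  shows "continuous_on A N"
proof -
  have "convex_on UNIV N"
  proof (rule convex_onI)
    fix t :: real and v w :: 'a
    assume t: "0 < t" "t < 1"
    have "N ((1 - t) *\<^sub>R v + t *\<^sub>R w) \<le> N ((1 - t) *\<^sub>R v) + N (t *\<^sub>R w)"
      using assms unfolding is_norm_def by blast
    also have "\<dots> = (1 - t) * N v + t * N w"
      using assms t by (simp add: is_norm_def)
    finally show "N ((1 - t) *\<^sub>R v + t *\<^sub>R w) \<le> (1 - t) * N v + t * N w" .
  qed simp
  then have "continuous_on UNIV N"
    by (intro convex_on_continuous) auto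
  then show ?thesis
    by (rule continuous_on_subset) simp
qed

lemma open_norm_ball:
  fixes N :: "'a::euclidean_space \<Rightarrow> real"
  assumes "is_norm N"
  shows "open {u. N (x - u) < r}"
proof -
  have "continuous_on UNIV (\<lambda>u. N (x - u))"
    by (intro continuous_on_compose2[OF is_norm_continuous[OF assms, of UNIV]] continuous_intros) auto
  then show ?thesis
    by (intro open_Collect_less) auto
qed

text \<open>The complement of the support is the union of the null sets in a countable base.\<close>

lemma AE_in_supp:
  fixes Q :: "'a::second_countable_topology measure"
  assumes Q: "sets Q = sets borel"
  shows "AE u in Q. u \<in> supp Q"
proof -
  obtain \<B> :: "'a set set" where \<B>: "countable \<B>" "topological_basis \<B>"
    using ex_countable_basis by blast
  have meas: "V \<in> sets Q" if "open V" for V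
    using that Q by simp
  have "AE u in Q. \<forall>V\<in>{V\<in>\<B>. emeasure Q V = 0}. u \<notin> V"
  proof (subst AE_ball_countable)
    show "countable {V\<in>\<B>. emeasure Q V = 0}"
      using \<B>(1) by (rule countable_subset[rotated]) auto
    show "\<forall>V\<in>{V\<in>\<B>. emeasure Q V = 0}. AE u in Q. u \<notin> V"
      using meas topological_basis_open[OF \<B>(2)] by (auto intro!: AE_not_in)
  qed
  then show ?thesis
  proof (rule AE_mp, intro AE_I2 impI)
    fix u assume u: "\<forall>V\<in>{V\<in>\<B>. emeasure Q V = 0}. u \<notin> V"
    show "u \<in> supp Q"
      unfolding supp_def
    proof (intro CollectI allI impI)
      fix V assume V: "open V" "u \<in> V"
      obtain W where W: "W \<in> \<B>" "u \<in> W" "W \<subseteq> V"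
        using topological_basisE[OF \<B>(2) V] by blast
      have "0 < emeasure Q W"
        using u W by (auto simp: zero_less_iff_neq_zero)
      also have "\<dots> \<le> emeasure Q V"
        using W V meas by (intro emeasure_mono) auto
      finally show "0 < emeasure Q V" .
    qed
  qed
qed

lemma dist_to_le:
  assumes "is_norm N" "u \<in> S"
  shows "dist_to N x S \<le> N (x - u)"
  unfolding dist_to_def
  using assms(2) by (intro cINF_lower) (auto intro!: bdd_belowI2[of _ 0] is_norm_nonneg[OF assms(1)])

lemma dist_to_nonneg:
  assumes "is_norm N" "S \<noteq> {}"
  shows "0 \<le> dist_to N x S"
  unfolding dist_to_def using assms by (intro cINF_greatest) (auto intro: is_norm_nonneg)

lemma dist_to_eq_0:
  assumes "is_norm N" "x \<in> S"
  shows "dist_to N x S = 0"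
  using dist_to_le[OF assms, of x] dist_to_nonneg[OF assms(1), of S x] assms
  by (auto simp: is_norm_zero)

lemma emeasure_norm_ball_pos:
  fixes N :: "'a::euclidean_space \<Rightarrow> real"
  assumes N: "is_norm N" and ne: "supp Q \<noteq> {}" and r: "dist_to N x (supp Q) < r"
  shows "0 < emeasure Q {u. N (x - u) < r}"
proof -
  obtain u where "u \<in> supp Q" "N (x - u) < r"
    using r ne unfolding dist_to_def
    by (subst (asm) cINF_less_iff) (auto intro!: bdd_belowI2[of _ 0] is_norm_nonneg[OF N])
  then show ?thesis
    using open_norm_ball[OF N, of x r] by (auto simp: supp_def)
qed

section \<open>Nearest neighbours\<close>

lemma length_nn_order: "length (nn_order N u n x) = n"
  by (simp add: nn_order_def)

lemma nn_in_sample: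
  assumes "j \<in> {1..n}"
  shows "\<exists>i\<in>{1..n}. nn N u n x j = u i"
proof -
  have "nn_order N u n x ! (j - 1) \<in> set (nn_order N u n x)"
    using assms by (intro nth_mem) (auto simp: length_nn_order)
  moreover have "set (nn_order N u n x) = {1..n}"
    by (auto simp: nn_order_def)
  ultimately show ?thesis
    unfolding nn_def by blast
qed

text \<open>If the \<open>j\<close>-th neighbour were at distance at least \<open>r\<close>, then so would be all later ones, which
  leaves only \<open>j - 1\<close> candidates for points closer than \<open>r\<close>.\<close>

lemma nn_less:
  assumes j: "1 \<le> j" and card: "j \<le> card {i\<in>{1..n}. N (x - u i) < r}"
  shows "N (x - nn N u n x j) < r"
proof (rule ccontr)
  let ?key = "\<lambda>i. N (x - u i)"
  define xs where "xs = nn_order N u n x"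
  assume "\<not> N (x - nn N u n x j) < r"
  then have far: "r \<le> ?key (xs ! (j - 1))"
    by (simp add: nn_def xs_def)
  have sorted: "sorted (map ?key xs)"
    by (simp add: xs_def nn_order_def)
  have "i < j - 1" if i: "i < length xs" "?key (xs ! i) < r" for i
  proof (rule ccontr)
    assume "\<not> i < j - 1"
    then have "?key (xs ! (j - 1)) \<le> ?key (xs ! i)"
      using sorted_nth_mono[OF sorted, of "j - 1" i] i by simp
    then show False
      using far i by simp
  qed
  then have "card {i. i < length xs \<and> ?key (xs ! i) < r} \<le> card {..<j - 1}"
    by (intro card_mono) auto
  moreover have "card {i. i < length xs \<and> ?key (xs ! i) < r} = card {i\<in>{1..n}. ?key i < r}"
  proof -
    have "card {i. i < length xs \<and> ?key (xs ! i) < r} = length (filter (\<lambda>i. ?key i < r) xs)"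
      by (simp add: length_filter_conv_card)
    also have "\<dots> = card (set (filter (\<lambda>i. ?key i < r) xs))"
      by (intro distinct_card[symmetric]) (simp add: xs_def nn_order_def)
    also have "set (filter (\<lambda>i. ?key i < r) xs) = {i\<in>{1..n}. ?key i < r}"
      by (auto simp: xs_def nn_order_def)
    finally show ?thesis .
  qed
  ultimately show False
    using card j by simp
qed

lemma w_fact_le:
  assumes k: "1 \<le> k" "k \<le> n"
    and d: "0 \<le> d" and far: "\<And>i. i \<in> {1..n} \<Longrightarrow> d \<le> N (x - u i)"
  shows "w_fact N u n k x \<le> exp (- d\<^sup>2)"
proof -
  have "(\<Sum>j=1..k. exp (- (N (x - nn N u n x j))\<^sup>2)) \<le> of_nat (card {1..k}) * exp (- d\<^sup>2)"
  proof (rule sum_bounded_above)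
    fix j assume "j \<in> {1..k}"
    then obtain i where "i \<in> {1..n}" "nn N u n x j = u i"
      using k nn_in_sample[of j n N u x] by auto
    then show "exp (- (N (x - nn N u n x j))\<^sup>2) \<le> exp (- d\<^sup>2)"
      using d far[of i] by (simp add: power_mono)
  qed
  then show ?thesis
    using k by (simp add: w_fact_def field_simps)
qed

lemma w_fact_ge:
  assumes N: "is_norm N" and k: "1 \<le> k"
    and card: "k \<le> card {i\<in>{1..n}. N (x - u i) < r}"
  shows "exp (- r\<^sup>2) \<le> w_fact N u n k x"
proof -
  have "of_nat (card {1..k}) * exp (- r\<^sup>2) \<le> (\<Sum>j=1..k. exp (- (N (x - nn N u n x j))\<^sup>2))"
  proof (rule sum_bounded_below)
    fix j assume "j \<in> {1..k}"
    then have "N (x - nn N u n x j) < r"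
      using card by (intro nn_less) auto
    then show "exp (- r\<^sup>2) \<le> exp (- (N (x - nn N u n x j))\<^sup>2)"
      using is_norm_nonneg[OF N] by (simp add: power_mono)
  qed
  then show ?thesis
    using k by (simp add: w_fact_def field_simps)
qed

text \<open>The deterministic half of the argument. Only the radii \<open>d + inverse (Suc m)\<close> are used, so that
  in the probabilistic setting the hypothesis on the counts fails on a null set only.\<close>

lemma w_fact_tendsto:
  assumes N: "is_norm N" and k: "\<And>n. n \<ge> 1 \<Longrightarrow> 1 \<le> k n \<and> k n \<le> n"
    and d: "0 \<le> d" and far: "\<And>i. i \<ge> 1 \<Longrightarrow> d \<le> N (x - u i)"
    and near: "\<And>m. eventually
        (\<lambda>n. k n \<le> card {i\<in>{1..n}. N (x - u i) < d + inverse (real (Suc m))}) sequentially"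
  shows "(\<lambda>n. w_fact N u n (k n) x) \<longlonglongrightarrow> exp (- d\<^sup>2)"
proof (rule order_tendstoI)
  fix a assume a: "a < exp (- d\<^sup>2)"
  have "(\<lambda>m. exp (- (d + inverse (real (Suc m)))\<^sup>2)) \<longlonglongrightarrow> exp (- (d + 0)\<^sup>2)"
    by (intro tendsto_intros LIMSEQ_inverse_real_of_nat)
  then have "eventually (\<lambda>m. a < exp (- (d + inverse (real (Suc m)))\<^sup>2)) sequentially"
    using a by (intro order_tendstoD(1)) auto
  then obtain m where m: "a < exp (- (d + inverse (real (Suc m)))\<^sup>2)"
    using eventually_happens' sequentially_bot by blast
  show "eventually (\<lambda>n. a < w_fact N u n (k n) x) sequentially"
    using near[of m] eventually_ge_at_top[of 1]
  proof eventually_elim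
    case (elim n)
    then show ?case
      using w_fact_ge[OF N _ elim(1)] k[of n] m by linarith
  qed
next
  fix a assume a: "exp (- d\<^sup>2) < a"
  show "eventually (\<lambda>n. w_fact N u n (k n) x < a) sequentially"
    using eventually_ge_at_top[of 1]
  proof eventually_elim
    case (elim n)
    have "w_fact N u n (k n) x \<le> exp (- d\<^sup>2)"
      using k[OF elim] d far by (intro w_fact_le) auto
    then show ?case
      using a by simp
  qed
qed

section \<open>Counting hits\<close>

text \<open>Hoeffding's inequality for the indicators of the events \<open>U i \<in> B\<close>, with deviation half the
  mean, bounds the probability of too few hits by a geometric sequence.\<close>

lemma (in prob_space) AE_eventually_card_hits:
  fixes U :: "nat \<Rightarrow> 'a \<Rightarrow> 'b::topological_space"
  assumes indep: "indep_vars (\<lambda>_. borel) U {1..}"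
    and law: "\<And>i. i \<ge> 1 \<Longrightarrow> distr M borel (U i) = Q"
    and B: "B \<in> sets borel" and pos: "0 < measure Q B"
  shows "AE \<omega> in M. eventually
           (\<lambda>n. real n * measure Q B / 2 < real (card {i\<in>{1..n}. U i \<omega> \<in> B})) sequentially"
proof -
  define p where "p = measure Q B"
  define X where "X = (\<lambda>i \<omega>. indicat_real B (U i \<omega>))"
  have U: "U i \<in> borel_measurable M" if "i \<ge> 1" for i
    using indep that by (auto simp: indep_vars_def)
  have X: "X i \<in> borel_measurable M" if "i \<ge> 1" for i
    unfolding X_def using measurable_compose[OF U[OF that] borel_measurable_indicator[OF B]] .
  have exp_X: "expectation (X i) = p" if "i \<ge> 1" for i
  proof -
    have "expectation (X i) = integral\<^sup>L (distr M borel (U i)) (indicat_real B)"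
      unfolding X_def using U[OF that] B by (intro integral_distr[symmetric]) auto
    also have "\<dots> = measure (distr M borel (U i)) B"
      using B by simp
    finally show ?thesis
      by (simp only: p_def law[OF that])
  qed
  have sum_X: "(\<Sum>i\<in>{1..n}. X i \<omega>) = real (card {i\<in>{1..n}. U i \<omega> \<in> B})" for n \<omega>
    unfolding X_def by (simp add: indicator_def sum.If_cases Int_def)
  define A where "A n = {\<omega>\<in>space M. (\<Sum>i\<in>{1..n}. X i \<omega>) \<le> real n * p - real n * p / 2}" for n
  have A: "A n \<in> events" for n
  proof -
    have "(\<lambda>\<omega>. \<Sum>i\<in>{1..n}. X i \<omega>) \<in> borel_measurable M"
      by (intro borel_measurable_sum X) auto
    then show ?thesis
      unfolding A_def by measurable
  qed
  have prob_A: "prob (A n) \<le> exp (- p\<^sup>2 / 2) ^ n" if n: "n \<ge> 1" for n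
  proof -
    interpret Hoeffding_ineq M "{1..n}" X "\<lambda>_. 0" "\<lambda>_. 1" "\<Sum>i\<in>{1..n}. expectation (X i)"
    proof unfold_locales
      have "indep_vars (\<lambda>_. borel) U {1..n}"
        by (rule indep_vars_subset[OF indep]) auto
      then show "indep_vars (\<lambda>_. borel) X {1..n}"
        unfolding X_def by (rule indep_vars_compose2) (use B in auto)
    qed (auto simp: X_def indicator_def)
    have "prob (A n) \<le> exp (- 2 * (real n * p / 2)\<^sup>2 / real n)"
      using Hoeffding_ineq_le[of "real n * p / 2"] n pos by (simp add: A_def exp_X p_def)
    also have "- 2 * (real n * p / 2)\<^sup>2 / real n = real n * (- p\<^sup>2 / 2)"
      using n by (simp add: power2_eq_square field_simps)
    finally show ?thesis
      by (simp only: exp_of_nat_mult)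
  qed
  have "summable (\<lambda>n. prob (A n))"
  proof (rule summable_comparison_test')
    show "summable (\<lambda>n. exp (- p\<^sup>2 / 2) ^ n)"
      using pos by (intro summable_geometric) (simp add: p_def)
    show "norm (prob (A n)) \<le> exp (- p\<^sup>2 / 2) ^ n" if "n \<ge> 1" for n
      using prob_A[OF that] by simp
  qed
  then have "AE \<omega> in M. eventually (\<lambda>n. \<omega> \<in> space M - A n) sequentially"
    using A by (intro borel_cantelli_AE1) (auto simp: less_top[symmetric])
  then show ?thesis
  proof (rule AE_mp, intro AE_I2 impI)
    fix \<omega> assume "eventually (\<lambda>n. \<omega> \<in> space M - A n) sequentially"
    then show "eventually
        (\<lambda>n. real n * measure Q B / 2 < real (card {i\<in>{1..n}. U i \<omega> \<in> B})) sequentially"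
    proof eventually_elim
      case (elim n)
      then have "real n * p - real n * p / 2 < (\<Sum>i\<in>{1..n}. X i \<omega>)"
        unfolding A_def by force
      then show ?case
        unfolding sum_X p_def by linarith
    qed
  qed
qed

section \<open>Convergence of the average\<close>

theorem proposition5:
  fixes N :: "real ^ 'd \<Rightarrow> real"
    and M :: "'w measure"
    and U :: "nat \<Rightarrow> 'w \<Rightarrow> real ^ 'd"
    and Q :: "(real ^ 'd) measure"
    and k :: "nat \<Rightarrow> nat"
    and x :: "real ^ 'd"
  assumes "is_norm N"
    and "prob_space M"
    and "prob_space.indep_vars M (\<lambda>_. borel) U {1..}"
    and "\<And>i. i \<ge> 1 \<Longrightarrow> distr M borel (U i) = Q"
    and "\<And>n. n \<ge> 1 \<Longrightarrow> 1 \<le> k n \<and> k n \<le> n"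
    and "(\<lambda>n. real (k n) / real n) \<longlonglongrightarrow> 0"
  shows "(AE \<omega> in M. (\<lambda>n. w_fact N (\<lambda>i. U i \<omega>) n (k n) x)
            \<longlonglongrightarrow> exp (- (dist_to N x (supp Q))\<^sup>2)) \<and>
         (x \<in> supp Q \<longrightarrow>
           (AE \<omega> in M. (\<lambda>n. w_fact N (\<lambda>i. U i \<omega>) n (k n) x) \<longlonglongrightarrow> 1))"
proof -
  interpret prob_space M by fact
  note N = assms(1) and indep = assms(3) and law = assms(4) and k = assms(5) and k0 = assms(6)
  define d where "d = dist_to N x (supp Q)"
  have U: "U i \<in> borel_measurable M" if "i \<ge> 1" for i
    using indep that by (auto simp: indep_vars_def)
  have sets_Q: "sets Q = sets borel"
    using law[of 1] by auto
  interpret Q: prob_space Q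
    using prob_space_distr[OF U[of 1]] law[of 1] by simp
  have ne: "supp Q \<noteq> {}"
  proof
    assume "supp Q = {}"
    then have "AE u in Q. False"
      using AE_in_supp[OF sets_Q] by simp
    then show False
      by simp
  qed
  have d: "0 \<le> d"
    unfolding d_def using N ne by (rule dist_to_nonneg)
  have far: "AE \<omega> in M. \<forall>i\<in>{1..}. d \<le> N (x - U i \<omega>)"
  proof (subst AE_ball_countable, simp, intro ballI)
    fix i :: nat assume "i \<in> {1..}"
    then have i: "i \<ge> 1"
      by simp
    have "AE u in distr M borel (U i). u \<in> supp Q"
      unfolding law[OF i] by (rule AE_in_supp[OF sets_Q])
    then have "AE \<omega> in M. U i \<omega> \<in> supp Q"
      by (rule AE_distrD[OF U[OF i]])
    then show "AE \<omega> in M. d \<le> N (x - U i \<omega>)"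
      by (rule AE_mp) (auto simp: d_def intro: dist_to_le[OF N])
  qed
  have near: "AE \<omega> in M. \<forall>m. eventually
      (\<lambda>n. k n \<le> card {i\<in>{1..n}. N (x - U i \<omega>) < d + inverse (real (Suc m))}) sequentially"
  proof (subst AE_all_countable, intro allI)
    fix m
    define B where "B = {u. N (x - u) < d + inverse (real (Suc m))}"
    have B: "B \<in> sets borel"
      unfolding B_def using open_norm_ball[OF N] by simp
    have "0 < emeasure Q B"
      unfolding B_def using N ne by (rule emeasure_norm_ball_pos) (simp add: d_def)
    then have pos: "0 < measure Q B"
      by (simp add: Q.emeasure_eq_measure)
    have "eventually (\<lambda>n. real (k n) / real n < measure Q B / 2) sequentially"
      using pos by (intro order_tendstoD(2)[OF k0]) simp
    then have few: "eventually (\<lambda>n. real (k n) \<le> real n * measure Q B / 2) sequentially"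
      using eventually_gt_at_top[of 0] by eventually_elim (simp add: field_simps)
    have "AE \<omega> in M. eventually
        (\<lambda>n. real n * measure Q B / 2 < real (card {i\<in>{1..n}. U i \<omega> \<in> B})) sequentially"
      using indep law B pos by (rule AE_eventually_card_hits)
    then show "AE \<omega> in M. eventually
      (\<lambda>n. k n \<le> card {i\<in>{1..n}. N (x - U i \<omega>) < d + inverse (real (Suc m))}) sequentially"
    proof (rule AE_mp, intro AE_I2 impI)
      fix \<omega>
      assume "eventually
        (\<lambda>n. real n * measure Q B / 2 < real (card {i\<in>{1..n}. U i \<omega> \<in> B})) sequentially"
      then have "eventually (\<lambda>n. k n \<le> card {i\<in>{1..n}. U i \<omega> \<in> B}) sequentially"
        using few by eventually_elim linarith
      then show "eventually
        (\<lambda>n. k n \<le> card {i\<in>{1..n}. N (x - U i \<omega>) < d + inverse (real (Suc m))}) sequentially"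
        by (simp add: B_def)
    qed
  qed
  have lim: "AE \<omega> in M. (\<lambda>n. w_fact N (\<lambda>i. U i \<omega>) n (k n) x) \<longlonglongrightarrow> exp (- d\<^sup>2)"
    using far near
  proof eventually_elim
    case (elim \<omega>)
    then show ?case
      by (intro w_fact_tendsto[OF N k d]) auto
  qed
  moreover have "d = 0" if "x \<in> supp Q"
    unfolding d_def using N that by (rule dist_to_eq_0)
  ultimately show ?thesis
    by (auto simp: d_def)
qed

end
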